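(* Let $M=\begin{pmatrix}1&1\\0&1\end{pmatrix}$, $v_1=(0,1)^T$ and $v_2=(0,-1)^T$. Let $L_0$ be the language, over the two-letter alphabet $\{v_1,v_2\}$, of all nonempty finite strings $v$ with $[v]_M=(0,0)^T$. Then $L_0$ belongs to the class LSPACE.
   Context: For a string $a_ka_{k-1}\cdots a_0$ of letters $a_i\in\{v_1,v_2\}$, its value in base $M$ is $[a_ka_{k-1}\cdots a_0]_M=M^ka_k+\dots+M a_1+a_0\in\mathbb{Z}^2$. LSPACE is the class of languages decided by a deterministic Turing machine with a read-only input tape that uses $\mathcal{O}(\log N)$ cells of work memory on inputs of length $N$. *)

theory Defs
  imports "HOL-Analysis.Analysis" "HOL-Library.Landau_Symbols"
begin

section \<open>The value of a string in a matrix base\<close>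

text \<open>The power \<open>^\<close> that the type class instances provide on \<open>int ^ 'n ^ 'n\<close> is
  entrywise, so powers with respect to the matrix product are defined here.\<close>

primrec matrix_power :: "int ^ 'n ^ 'n \<Rightarrow> nat \<Rightarrow> int ^ 'n ^ 'n" where
  "matrix_power M 0 = mat 1"
| "matrix_power M (Suc k) = M ** matrix_power M k"

text \<open>A string is a list with its leftmost letter first, so the letter \<open>a\<^sub>i\<close> of
  \<open>a\<^sub>k \<dots> a\<^sub>0\<close> is \<open>rev w ! i\<close>.\<close>

definition base_value :: "int ^ 'n ^ 'n \<Rightarrow> (int ^ 'n) list \<Rightarrow> int ^ 'n" where
  "base_value M w = (\<Sum>i<length w. matrix_power M i *v (rev w ! i))"

section \<open>Turing machines with a read-only input tape\<close>

datatype dir = Go_Left | Stay | Go_Right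

text \<open>The input word stands on cells \<open>1, \<dots>, N\<close> of the input tape, between end markers on
  cells \<open>0\<close> and \<open>N + 1\<close>.\<close>

datatype 'a input_cell = Left_End | Letter 'a | Right_End

definition input_cell :: "'a list \<Rightarrow> nat \<Rightarrow> 'a input_cell" where
  "input_cell w i =
    (if i = 0 then Left_End else if i \<le> length w then Letter (w ! (i - 1)) else Right_End)"

text \<open>States and work symbols are named by natural numbers, which is no restriction as there
  are finitely many of each. A transition gives the new state, the symbol written
  on the work tape, the move of the input head and the move of the work head; there is no
  component for writing on the input tape.\<close>

record 'a machine =
  states :: "nat set"
  work_symbols :: "nat set"
  blank :: nat
  start_state :: nat
  accept_state :: nat
  reject_state :: nat
  transition :: "nat \<Rightarrow> 'a input_cell \<Rightarrow> nat \<Rightarrow> nat \<times> nat \<times> dir \<times> dir"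

definition machine_over :: "'a set \<Rightarrow> 'a machine \<Rightarrow> bool" where
  "machine_over \<Sigma> T \<longleftrightarrow>
     finite \<Sigma> \<and> finite (states T) \<and> finite (work_symbols T) \<and>
     blank T \<in> work_symbols T \<and> start_state T \<in> states T \<and>
     accept_state T \<in> states T \<and> reject_state T \<in> states T \<and>
     accept_state T \<noteq> reject_state T \<and>
     (\<forall>q \<in> states T. \<forall>c \<in> {Left_End, Right_End} \<union> Letter ` \<Sigma>. \<forall>g \<in> work_symbols T.
        case transition T q c g of (q', g', _, _) \<Rightarrow> q' \<in> states T \<and> g' \<in> work_symbols T)"

text \<open>The work tape is infinite in both directions.\<close>

record config =
  state :: nat
  input_pos :: nat
  work_tape :: "int \<Rightarrow> nat"
  work_pos :: int

text \<open>The input head cannot leave the marked region: a move past an end marker leaves it in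
  place. Otherwise its distance from the input would be an unbounded counter for which no work
  cells are charged.\<close>

fun move_input :: "nat \<Rightarrow> dir \<Rightarrow> nat \<Rightarrow> nat" where
  "move_input N Go_Left i = i - 1"
| "move_input N Stay i = i"
| "move_input N Go_Right i = min (i + 1) (N + 1)"

fun move_work :: "dir \<Rightarrow> int \<Rightarrow> int" where
  "move_work Go_Left p = p - 1"
| "move_work Stay p = p"
| "move_work Go_Right p = p + 1"

definition initial_config :: "'a machine \<Rightarrow> config" where
  "initial_config T =
    \<lparr>state = start_state T, input_pos = 0, work_tape = (\<lambda>_. blank T), work_pos = 0\<rparr>"

text \<open>Halted configurations are fixed points of the step function.\<close>

definition step :: "'a machine \<Rightarrow> 'a list \<Rightarrow> config \<Rightarrow> config" where
  "step T w c =
    (if state c = accept_state T \<or> state c = reject_state T then c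
     else case transition T (state c) (input_cell w (input_pos c)) (work_tape c (work_pos c)) of
       (q, g, d, e) \<Rightarrow>
         \<lparr>state = q,
          input_pos = move_input (length w) d (input_pos c),
          work_tape = (work_tape c)(work_pos c := g),
          work_pos = move_work e (work_pos c)\<rparr>)"

definition config_at :: "'a machine \<Rightarrow> 'a list \<Rightarrow> nat \<Rightarrow> config" where
  "config_at T w t = (step T w ^^ t) (initial_config T)"

definition decides :: "'a set \<Rightarrow> 'a machine \<Rightarrow> 'a list set \<Rightarrow> bool" where
  "decides \<Sigma> T L \<longleftrightarrow>
     L \<subseteq> lists \<Sigma> \<and>
     (\<forall>w \<in> lists \<Sigma>. \<exists>t. state (config_at T w t) =
        (if w \<in> L then accept_state T else reject_state T))"

text \<open>The number of work cells that the head visits in the whole computation on \<open>w\<close>; this set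
  of cells is finite whenever the machine halts on \<open>w\<close>.\<close>

definition work_space :: "'a machine \<Rightarrow> 'a list \<Rightarrow> nat" where
  "work_space T w = card (range (\<lambda>t. work_pos (config_at T w t)))"

definition LSPACE :: "'a set \<Rightarrow> 'a list set set" where
  "LSPACE \<Sigma> = {L. \<exists>T. machine_over \<Sigma> T \<and> decides \<Sigma> T L \<and>
     (\<exists>s :: nat \<Rightarrow> nat. (\<forall>w \<in> lists \<Sigma>. work_space T w \<le> s (length w)) \<and>
        (\<lambda>N. real (s N)) \<in> O(\<lambda>N. ln (real N)))}"

end

theory Submission
  imports Defs
begin

text \<open>Appending a letter \<open>a\<close> to a string turns its value \<open>u\<close> into \<open>M u + a\<close>. Hence the value is zero
  iff two pairs of natural numbers agree: the numbers of \<open>v\<^sub>1\<close> and of \<open>v\<^sub>2\<close>, and the sums of these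
  numbers over all proper prefixes. A machine keeps these four counters, which are at most \<open>N\<^sup>2\<close>, in
  binary on four tracks of its work tape, least significant bits first. For each letter one sweep
  over the work tape updates all counters simultaneously by serial addition.\<close>

section \<open>Serial binary addition\<close>

text \<open>The carry into position \<open>k\<close> in closed form, with \<open>c\<close> the carry
  into position 0. The bitwise recursion is derived from it in \<open>carry_Suc\<close>.\<close>

definition carry :: "nat \<Rightarrow> nat \<Rightarrow> bool \<Rightarrow> nat \<Rightarrow> bool" where
  "carry a b c k \<longleftrightarrow> 2 ^ k \<le> a mod 2 ^ k + b mod 2 ^ k + of_bool c"

lemma carry_0 [simp]: "carry a b c 0 = c"
  by (simp add: carry_def)

lemma mod_power_Suc_bit:
  "(a :: nat) mod 2 ^ Suc k = a mod 2 ^ k + 2 ^ k * of_bool (bit a k)"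
proof -
  have "a mod (2 ^ k * 2) = 2 ^ k * (a div 2 ^ k mod 2) + a mod 2 ^ k"
    by (rule mod_mult2_eq)
  then show ?thesis
    by (simp add: bit_iff_odd mod_2_eq_odd mult.commute)
qed

text \<open>Each remainder gains its top bit times \<open>2 ^ k\<close>. Two set bits always
  overflow, none never do, and a single one does iff there is a carry from below.\<close>

lemma carry_Suc:
  "carry a b c (Suc k) \<longleftrightarrow>
    bit a k \<and> bit b k \<or> bit a k \<and> carry a b c k \<or> bit b k \<and> carry a b c k"
proof -
  have "2 * m \<le> x + m * of_bool p + (y + m * of_bool q) + of_bool c \<longleftrightarrow>
      p \<and> q \<or> p \<and> m \<le> x + y + of_bool c \<or> q \<and> m \<le> x + y + of_bool c"
    if "x < m" "y < m" for x y m :: nat and p q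
    using that by (cases p; cases q; cases c) auto
  then show ?thesis
    unfolding carry_def mod_power_Suc_bit unfolding power_Suc by simp
qed

text \<open>The low parts add up to less than \<open>2 * 2 ^ k\<close>, so their quotient by
  \<open>2 ^ k\<close> is just the carry; the claim is the parity of the sum of the three
  quotients.\<close>

lemma bit_add_carry:
  "bit (a + b + of_bool c :: nat) k \<longleftrightarrow> (bit a k \<noteq> (bit b k \<noteq> carry a b c k))"
proof -
  let ?m = "a mod 2 ^ k + b mod 2 ^ k + of_bool c"
  have "a mod 2 ^ k < 2 ^ k" "b mod 2 ^ k < 2 ^ k" "of_bool c \<le> (1 :: nat)"
    by simp_all
  then have "?m < 2 * 2 ^ k"
    by linarith
  then have m: "?m div 2 ^ k = of_bool (carry a b c k)"
    by (auto simp: carry_def div_nat_eqI)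
  have "a + b + of_bool c = ?m + 2 ^ k * (a div 2 ^ k + b div 2 ^ k)"
    by (simp add: algebra_simps)
  then have "(a + b + of_bool c) div 2 ^ k = (?m + 2 ^ k * (a div 2 ^ k + b div 2 ^ k)) div 2 ^ k"
    by (rule arg_cong)
  also have "\<dots> = a div 2 ^ k + b div 2 ^ k + ?m div 2 ^ k"
    by (rule div_mult_self2) simp
  finally have "(a + b + of_bool c) div 2 ^ k = a div 2 ^ k + b div 2 ^ k + ?m div 2 ^ k" .
  then show ?thesis
    unfolding m by (auto simp: bit_iff_odd)
qed

lemma carry_beyond:
  assumes "a < 2 ^ k" "b < 2 ^ k"
  shows "carry a b c k \<longleftrightarrow> 2 ^ k \<le> a + b + of_bool c"
  using assms by (simp add: carry_def)

section \<open>The counters\<close>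

text \<open>A counter is named by a pair of the letter it concerns (\<open>True\<close> for the letter \<open>p\<close>) and the
  flag that tells the sum over prefixes from the plain number of occurrences.\<close>

type_synonym 'b counters = "bool \<times> bool \<Rightarrow> 'b"

text \<open>The neutral value \<open>z\<close> is a parameter so that one definition serves whole
  numbers (0) and single bits (\<open>False\<close>).\<close>

definition addend :: "'b \<Rightarrow> 'b counters \<Rightarrow> 'b counters" where
  "addend z V = (\<lambda>(s, l). if l then V (s, False) else z)"

definition increment :: "'a \<Rightarrow> 'a \<Rightarrow> bool counters" where
  "increment p a = (\<lambda>(s, l). \<not> l \<and> s = (a = p))"

definition update :: "'a \<Rightarrow> 'a \<Rightarrow> nat counters \<Rightarrow> nat counters" where
  "update p a V = (\<lambda>c. V c + addend 0 V c + of_bool (increment p a c))"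

definition counts :: "'a \<Rightarrow> 'a list \<Rightarrow> nat counters" where
  "counts p w = fold (update p) w (\<lambda>_. 0)"

lemma counts_Nil [simp]: "counts p [] = (\<lambda>_. 0)"
  by (simp add: counts_def)

lemma counts_snoc [simp]: "counts p (w @ [a]) = update p a (counts p w)"
  by (simp add: counts_def)

text \<open>A prefix sum grows by the old plain count, hence by at most the old length N, and N^2 +
  N is at most (N + 1)^2. The induction therefore needs both bounds together.\<close>

lemma counts_le: "counts p w (s, False) \<le> length w \<and> counts p w (s, True) \<le> (length w)\<^sup>2"
proof (induction w rule: rev_induct)
  case (snoc a w)
  then show ?case
    by (auto simp: update_def addend_def increment_def power2_eq_square intro: le_SucI)
qed simp

lemma counts_le_square: "counts p w c \<le> (length w)\<^sup>2"
proof -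
  obtain s l where "c = (s, l)"
    by (cases c)
  moreover have "length w \<le> (length w)\<^sup>2"
    by (cases "length w") (simp_all add: power2_eq_square)
  ultimately show ?thesis
    using counts_le[of p w s] by (cases l) auto
qed

section \<open>The common binary width of the four counters\<close>

definition width :: "nat counters \<Rightarrow> nat" where
  "width V = (LEAST n. \<forall>c. V c < 2 ^ n)"

lemma width_le: "(\<And>c. V c < 2 ^ n) \<Longrightarrow> width V \<le> n"
  unfolding width_def by (rule Least_le) blast

lemma less_power_width: "V c < 2 ^ width V"
proof -
  \<comment> \<open>Some exponent must exist for the least one to be meaningful; the sum of all
    counters is a crude witness.\<close>
  have "\<forall>c. V c < 2 ^ (\<Sum>c\<in>UNIV. V c)"
  proof
    fix c
    have "V c \<le> (\<Sum>c\<in>UNIV. V c)"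
      by (rule member_le_sum) auto
    also have "\<dots> < 2 ^ (\<Sum>c\<in>UNIV. V c)"
      by (rule less_exp)
    finally show "V c < 2 ^ (\<Sum>c\<in>UNIV. V c)" .
  qed
  then have "\<forall>c. V c < 2 ^ width V"
    unfolding width_def by (rule LeastI)
  then show ?thesis ..
qed

lemma less_power_if_width_le: "width V \<le> k \<Longrightarrow> V c < 2 ^ k"
  by (rule less_le_trans[OF less_power_width]) simp

text \<open>Minimality of the width enters here; it will show that a sweep cannot stop too
  early.\<close>

lemma ex_ge_power_if_less_width: "k < width V \<Longrightarrow> \<exists>c. 2 ^ k \<le> V c"
  using width_le[of V k] by (meson not_le)

lemma width_mono: "(\<And>c. V c \<le> V' c) \<Longrightarrow> width V \<le> width V'"
  by (meson less_power_width order_le_less_trans width_le)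

lemma width_0 [simp]: "width (\<lambda>_. 0) = 0"
  using width_le[of "\<lambda>_. 0" 0] by simp

lemma width_update: "width V \<le> width (update p a V)"
  by (rule width_mono) (simp add: update_def)

text \<open>One plain count has just been incremented. Hence cell 0 is nonblank after any nonempty
  input, which separates that case from the empty string.\<close>

lemma width_update_pos: "0 < width (update p a V)"
proof (rule ccontr)
  assume "\<not> 0 < width (update p a V)"
  then have "update p a V (a = p, False) < 1"
    using less_power_width[of "update p a V" "(a = p, False)"] by simp
  then show False
    by (simp add: update_def increment_def)
qed

lemma addend_less: "width V \<le> k \<Longrightarrow> addend 0 V c < 2 ^ k"
  by (cases c) (simp add: addend_def less_power_if_width_le)

section \<open>The machine\<close>

datatype phase = Read | Sweep "bool counters" | Back | Check | Accept | Reject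

lemma finite_phase: "finite (UNIV :: phase set)"
proof -
  have "(UNIV :: phase set) \<subseteq> range Sweep \<union> {Read, Back, Check, Accept, Reject}"
    using phase.exhaust by blast
  then show ?thesis
    by (rule finite_subset) simp
qed

type_synonym cell = "bool counters option"

text \<open>A blank cell is read as leading zeros, so counters can grow during a sweep.\<close>

definition bits :: "cell \<Rightarrow> bool counters" where
  "bits g = (case g of None \<Rightarrow> (\<lambda>_. False) | Some d \<Rightarrow> d)"

text \<open>The bit to be added to a prefix sum lies in the same cell, on the track of the plain
  count, and is used before being overwritten. So all additions share one pass.\<close>

definition carry_bit :: "bool counters \<Rightarrow> bool counters \<Rightarrow> bool counters" where
  "carry_bit r d = (\<lambda>c. d c \<and> addend False d c \<or> d c \<and> r c \<or> addend False d c \<and> r c)"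

definition sum_bit :: "bool counters \<Rightarrow> bool counters \<Rightarrow> bool counters" where
  "sum_bit r d = (\<lambda>c. d c \<noteq> (addend False d c \<noteq> r c))"

text \<open>The work cell under the head in phase \<open>Read\<close> is still blank at the right end only if the input
  is empty.\<close>

fun delta :: "'a \<Rightarrow> phase \<Rightarrow> 'a input_cell \<Rightarrow> cell \<Rightarrow> phase \<times> cell \<times> dir \<times> dir" where
  "delta p Read Left_End g = (Read, g, Go_Right, Stay)"
| "delta p Read (Letter a) g = (Sweep (increment p a), g, Stay, Stay)"
| "delta p Read Right_End None = (Reject, None, Stay, Stay)"
| "delta p Read Right_End (Some d) = (Check, Some d, Stay, Stay)"
| "delta p (Sweep r) x g =
    (if g = None \<and> r = (\<lambda>_. False) then (Back, None, Stay, Go_Left)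
     else (Sweep (carry_bit r (bits g)), Some (sum_bit r (bits g)), Stay, Go_Right))"
| "delta p Back x (Some d) = (Back, Some d, Stay, Go_Left)"
| "delta p Back x None = (Read, None, Go_Right, Go_Right)"
| "delta p Check x None = (Accept, None, Stay, Stay)"
| "delta p Check x (Some d) =
    (if \<forall>l. d (True, l) = d (False, l) then (Check, Some d, Stay, Go_Right)
     else (Reject, Some d, Stay, Stay))"
| "delta p Accept x g = (Accept, g, Stay, Stay)"
| "delta p Reject x g = (Reject, g, Stay, Stay)"

section \<open>Numbering of phases and cell contents\<close>

definition enc :: "'b \<Rightarrow> nat" where
  "enc = to_nat_on UNIV"

definition dec :: "nat \<Rightarrow> 'b" where
  "dec = from_nat_into UNIV"

lemma dec_enc_phase [simp]: "dec (enc q) = (q :: phase)"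
  by (simp add: dec_def enc_def countable_finite finite_phase)

lemma dec_enc_cell [simp]: "dec (enc g) = (g :: cell)"
  by (simp add: dec_def enc_def countable_finite)

lemma enc_phase_eq_iff [simp]: "enc q = enc q' \<longleftrightarrow> q = (q' :: phase)"
  by (metis dec_enc_phase)

definition counter_machine :: "'a \<Rightarrow> 'a machine" where
  "counter_machine p =
    \<lparr>states = range (enc :: phase \<Rightarrow> nat), work_symbols = range (enc :: cell \<Rightarrow> nat),
     blank = enc (None :: cell), start_state = enc Read,
     accept_state = enc Accept, reject_state = enc Reject,
     transition = (\<lambda>q x g. case delta p (dec q) x (dec g) of
       (q', g', d, e) \<Rightarrow> (enc q', enc g', d, e))\<rparr>"

lemma machine_over_counter_machine: "finite \<Sigma> \<Longrightarrow> machine_over \<Sigma> (counter_machine p)"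
  by (auto simp: machine_over_def counter_machine_def finite_phase split: prod.split)

definition conf :: "phase \<Rightarrow> nat \<Rightarrow> (int \<Rightarrow> cell) \<Rightarrow> int \<Rightarrow> config" where
  "conf q i t k = \<lparr>state = enc q, input_pos = i, work_tape = enc \<circ> t, work_pos = k\<rparr>"

lemma conf_simps [simp]: "state (conf q i t k) = enc q" "work_pos (conf q i t k) = k"
  by (simp_all add: conf_def)

lemma initial_config_counter_machine:
  "initial_config (counter_machine p) = conf Read 0 (\<lambda>_. None) 0"
  by (simp add: initial_config_def counter_machine_def conf_def comp_def)

lemma step_conf:
  assumes "delta p q (input_cell w i) (t k) = (q', g, d, e)" "q \<noteq> Accept" "q \<noteq> Reject"
  shows "step (counter_machine p) w (conf q i t k) =
    conf q' (move_input (length w) d i) (t(k := g)) (move_work e k)"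
  using assms by (auto simp: step_def counter_machine_def conf_def)

section \<open>Computations on a bounded part of the work tape\<close>

definition step_in :: "'a machine \<Rightarrow> 'a list \<Rightarrow> int set \<Rightarrow> config \<Rightarrow> config \<Rightarrow> bool" where
  "step_in T w P c c' \<longleftrightarrow> step T w c = c' \<and> work_pos c' \<in> P"

text \<open>Cells 0 to n - 1 hold the counters; cells -1 and n are included because they may serve
  as the blanks at which the head turns or stops.\<close>

abbreviation run :: "'a \<Rightarrow> 'a list \<Rightarrow> nat \<Rightarrow> config \<Rightarrow> config \<Rightarrow> bool" where
  "run p w n \<equiv> (step_in (counter_machine p) w {-1..int n})\<^sup>*\<^sup>*"

lemma run_step:
  assumes "delta p q (input_cell w i) (t k) = (q', g, d, e)" "q \<noteq> Accept" "q \<noteq> Reject"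
    and "i' = move_input (length w) d i" "t' = t(k := g)" "k' = move_work e k"
    and "-1 \<le> k'" "k' \<le> int n"
  shows "run p w n (conf q i t k) (conf q' i' t' k')"
  using assms by (intro r_into_rtranclp) (simp add: step_in_def step_conf)

text \<open>The step function is deterministic, so a chain of steps is an iterate, and its
  intermediate configurations are exactly those met earlier.\<close>

lemma step_in_funpow:
  assumes "(step_in T w P)\<^sup>*\<^sup>* c c'" "work_pos c \<in> P"
  shows "\<exists>t. (step T w ^^ t) c = c' \<and> (\<forall>s\<le>t. work_pos ((step T w ^^ s) c) \<in> P)"
  using assms
proof (induction rule: rtranclp_induct)
  case base
  then show ?case
    by (intro exI[of _ 0]) simp
next
  case (step y z)
  then obtain t where t: "(step T w ^^ t) c = y"
    "\<forall>s\<le>t. work_pos ((step T w ^^ s) c) \<in> P"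
    by blast
  with step(2) have "(step T w ^^ Suc t) c = z" "work_pos z \<in> P"
    by (auto simp: step_in_def)
  with t(2) show ?case
    by (intro exI[of _ "Suc t"]) (auto simp: le_Suc_eq)
qed

text \<open>A halted configuration is a fixed point, so the whole infinite computation visits no
  cell beyond those visited up to the halt.\<close>

lemma halting_run:
  assumes "(step_in T w P)\<^sup>*\<^sup>* (initial_config T) c" "0 \<in> P"
    and "state c = accept_state T \<or> state c = reject_state T"
  shows "\<exists>t. config_at T w t = c" and "work_pos (config_at T w t) \<in> P"
proof -
  have "work_pos (initial_config T) \<in> P"
    using assms(2) by (simp add: initial_config_def)
  from step_in_funpow[OF assms(1) this] obtain n where n: "config_at T w n = c"
    "\<forall>s\<le>n. work_pos (config_at T w s) \<in> P"
    unfolding config_at_def by blast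
  then show "\<exists>t. config_at T w t = c"
    by blast
  have fix_c: "config_at T w (n + j) = c" for j
    using n(1) assms(3) by (induction j) (auto simp: config_at_def step_def)
  show "work_pos (config_at T w t) \<in> P"
  proof (cases "t \<le> n")
    case False
    then have "config_at T w t = config_at T w n"
      using fix_c[of "t - n"] fix_c[of 0] by simp
    then show ?thesis
      using n(2) by simp
  qed (use n(2) in blast)
qed

section \<open>Correctness of the machine\<close>

definition tape :: "nat counters \<Rightarrow> int \<Rightarrow> cell" where
  "tape V = (\<lambda>j. if 0 \<le> j \<and> j < int (width V) then Some (\<lambda>c. bit (V c) (nat j)) else None)"

text \<open>The invariant of a sweep: new bits to the left of the head, the untouched old tape from
  the head on.\<close>

definition half_swept :: "nat counters \<Rightarrow> nat counters \<Rightarrow> nat \<Rightarrow> int \<Rightarrow> cell" where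
  "half_swept V V' k = (\<lambda>j. if 0 \<le> j \<and> j < int k then Some (\<lambda>c. bit (V' c) (nat j)) else tape V j)"

lemma half_swept_0 [simp]: "half_swept V V' 0 = tape V"
  by (rule ext) (auto simp: half_swept_def)

lemma half_swept_Suc:
  "half_swept V V' (Suc k) = (half_swept V V' k)(int k := Some (\<lambda>c. bit (V' c) k))"
  by (rule ext) (auto simp: half_swept_def)

lemma half_swept_width:
  "width V \<le> width V' \<Longrightarrow> half_swept V V' (width V') = tape V'"
  by (rule ext) (auto simp: half_swept_def tape_def)

lemma not_bit_if_less: "(n :: nat) < 2 ^ k \<Longrightarrow> \<not> bit n k"
  by (simp add: bit_iff_odd)

lemma bits_tape: "bits (tape V (int k)) = (\<lambda>c. bit (V c) k)"
  by (auto simp: bits_def tape_def fun_eq_iff less_power_if_width_le not_bit_if_less)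

lemma bit_addend: "addend False (\<lambda>c. bit (V c) k) c = bit (addend 0 V c :: nat) k"
  by (cases c) (simp add: addend_def)

definition carries :: "'a \<Rightarrow> 'a \<Rightarrow> nat counters \<Rightarrow> nat \<Rightarrow> bool counters" where
  "carries p a V k = (\<lambda>c. carry (V c) (addend 0 V c) (increment p a c) k)"

lemma carry_bit_carries: "carry_bit (carries p a V k) (\<lambda>c. bit (V c) k) = carries p a V (Suc k)"
  by (simp add: carry_bit_def carries_def carry_Suc bit_addend)

lemma sum_bit_carries: "sum_bit (carries p a V k) (\<lambda>c. bit (V c) k) = (\<lambda>c. bit (update p a V c) k)"
  by (simp add: sum_bit_def carries_def update_def bit_add_carry bit_addend)

text \<open>Past the old counters, a pending carry means that the new counter still needs a bit
  here. So a sweep ends exactly at the new width.\<close>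

lemma carries_beyond:
  assumes "width V \<le> k"
  shows "carries p a V k c \<longleftrightarrow> 2 ^ k \<le> update p a V c"
  using assms by (simp add: carries_def update_def carry_beyond less_power_if_width_le addend_less)

section \<open>Processing the input letters\<close>

lemma run_sweep:
  assumes "k \<le> width (update p a V)" "width (update p a V) \<le> n"
  shows "run p w n (conf (Sweep (increment p a)) i (tape V) 0)
    (conf (Sweep (carries p a V k)) i (half_swept V (update p a V) k) (int k))"
  using assms(1)
proof (induction k)
  case 0
  show ?case
    by (simp add: carries_def)
next
  case (Suc k)
  let ?t = "half_swept V (update p a V)"
  have cell: "?t k (int k) = tape V (int k)"
    by (simp add: half_swept_def)
  \<comment> \<open>The sweep must go on: below the old width the cell is nonblank, and from there
    up to the new width some carry is pending.\<close>
  have "tape V (int k) \<noteq> None \<or> carries p a V k \<noteq> (\<lambda>_. False)"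
  proof (cases "k < width V")
    case False
    then have "\<exists>c. carries p a V k c"
      using Suc.prems ex_ge_power_if_less_width[of k "update p a V"] by (simp add: carries_beyond)
    then show ?thesis
      by auto
  qed (simp add: tape_def)
  then have "delta p (Sweep (carries p a V k)) (input_cell w i) (?t k (int k)) =
      (Sweep (carries p a V (Suc k)), Some (\<lambda>c. bit (update p a V c) k), Stay, Go_Right)"
    unfolding delta.simps cell bits_tape carry_bit_carries sum_bit_carries
    by (intro if_not_P) blast
  then have move: "run p w n (conf (Sweep (carries p a V k)) i (?t k) (int k))
      (conf (Sweep (carries p a V (Suc k))) i (?t (Suc k)) (int (Suc k)))"
    by (rule run_step) (use Suc.prems assms(2) in \<open>auto simp: half_swept_Suc\<close>)
  show ?case
    using rtranclp_trans[OF Suc.IH move] Suc.prems by simp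
qed

lemma run_back:
  assumes "k \<le> width V" "width V \<le> n"
  shows "run p w n (conf Back i (tape V) (int k - 1)) (conf Back i (tape V) (-1))"
  using assms(1)
proof (induction k)
  case (Suc k)
  have "delta p Back (input_cell w i) (tape V (int k)) =
      (Back, tape V (int k), Stay, Go_Left)"
    using Suc.prems by (simp add: tape_def)
  then have move: "run p w n (conf Back i (tape V) (int k)) (conf Back i (tape V) (int k - 1))"
    by (rule run_step) (use Suc.prems assms(2) in auto)
  show ?case
    using rtranclp_trans[OF move Suc.IH] Suc.prems by simp
qed simp

lemma run_letter:
  assumes "i < length w" "width (update p (w ! i) V) \<le> n"
  shows "run p w n (conf Read (Suc i) (tape V) 0)
    (conf Read (Suc (Suc i)) (tape (update p (w ! i) V)) 0)"
proof -
  let ?a = "w ! i"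
  let ?V = "update p ?a V"
  let ?k = "width ?V"
  \<comment> \<open>At the new width every counter fits, so no carry is left; the cell is blank too,
    and the head turns back.\<close>
  have no_carry: "carries p ?a V ?k = (\<lambda>_. False)"
    by (simp add: fun_eq_iff carries_beyond[OF width_update] less_power_width not_le)
  have "run p w n (conf Read (Suc i) (tape V) 0)
      (conf (Sweep (increment p ?a)) (Suc i) (tape V) 0)"
    by (rule run_step[where g = "tape V 0" and d = Stay and e = Stay])
      (use assms in \<open>auto simp: input_cell_def\<close>)
  also have "run p w n \<dots> (conf (Sweep (\<lambda>_. False)) (Suc i) (tape ?V) (int ?k))"
    using run_sweep[OF order_refl assms(2)] unfolding no_carry half_swept_width[OF width_update] .
  also have "run p w n \<dots>
      (conf Back (Suc i) (tape ?V) (int ?k - 1))"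
    by (rule run_step[where g = None and d = Stay and e = Go_Left])
      (use assms in \<open>auto simp: tape_def\<close>)
  also have "run p w n \<dots> (conf Back (Suc i) (tape ?V) (-1))"
    using assms(2) by (intro run_back) auto
  \<comment> \<open>The blank cell -1 ends the return; one step brings the work head to cell 0 and
    the input head to the next letter.\<close>
  also have "run p w n \<dots> (conf Read (Suc (Suc i)) (tape ?V) 0)"
    by (rule run_step[where g = None and d = Go_Right and e = Go_Right])
      (use assms in \<open>auto simp: tape_def\<close>)
  finally show ?thesis .
qed

lemma run_read:
  assumes "\<And>j. j \<le> length w \<Longrightarrow> width (counts p (take j w)) \<le> n" "i \<le> length w"
  shows "run p w n (conf Read 0 (\<lambda>_. None) 0) (conf Read (Suc i) (tape (counts p (take i w))) 0)"
  using assms(2)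
proof (induction i)
  case 0
  \<comment> \<open>Zero counters have width 0, so the blank initial tape already encodes
    them.\<close>
  have "tape (\<lambda>_. 0) = (\<lambda>_. None)"
    by (simp add: tape_def fun_eq_iff)
  then have "run p w n (conf Read 0 (\<lambda>_. None) 0) (conf Read (Suc 0) (tape (\<lambda>_. 0)) 0)"
    by (intro run_step[where g = None and d = Go_Right and e = Stay]) (auto simp: input_cell_def)
  then show ?case
    by simp
next
  case (Suc i)
  have "counts p (take (Suc i) w) = update p (w ! i) (counts p (take i w))"
    using Suc.prems by (simp add: take_Suc_conv_app_nth)
  then have move: "run p w n (conf Read (Suc i) (tape (counts p (take i w))) 0)
      (conf Read (Suc (Suc i)) (tape (counts p (take (Suc i) w))) 0)"
    using run_letter[of i w p "counts p (take i w)" n] assms(1)[of "Suc i"] Suc.prems by simp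
  show ?case
    using rtranclp_trans[OF Suc.IH move] Suc.prems by simp
qed

section \<open>The final comparison of the counters\<close>

lemma run_check:
  assumes "k \<le> width V" "width V \<le> n"
    and "\<And>j l. j < k \<Longrightarrow> bit (V (True, l)) j = bit (V (False, l)) j"
  shows "run p w n (conf Check i (tape V) 0) (conf Check i (tape V) (int k))"
  using assms(1,3)
proof (induction k)
  case (Suc k)
  have "delta p Check (input_cell w i) (tape V (int k)) = (Check, tape V (int k), Stay, Go_Right)"
    using Suc.prems by (simp add: tape_def)
  then have move: "run p w n (conf Check i (tape V) (int k)) (conf Check i (tape V) (int (Suc k)))"
    by (rule run_step) (use Suc.prems assms(2) in auto)
  show ?case
    using rtranclp_trans[OF Suc.IH move] Suc.prems by simp
qed simp

lemma run_accept:
  assumes "width V \<le> n" "\<And>l. V (True, l) = V (False, l)"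
  shows "run p w n (conf Check i (tape V) 0) (conf Accept i (tape V) (int (width V)))"
proof -
  have "run p w n (conf Check i (tape V) 0) (conf Check i (tape V) (int (width V)))"
    using assms by (intro run_check) auto
  also have "run p w n \<dots> (conf Accept i (tape V) (int (width V)))"
    by (rule run_step[where g = None and d = Stay and e = Stay])
      (use assms in \<open>auto simp: tape_def\<close>)
  finally show ?thesis .
qed

lemma run_reject:
  assumes "width V \<le> n" "V (True, l) \<noteq> V (False, l)"
  shows "\<exists>k. run p w n (conf Check i (tape V) 0) (conf Reject i (tape V) (int k))"
proof -
  define differ where "differ k \<longleftrightarrow> (\<exists>l. bit (V (True, l)) k \<noteq> bit (V (False, l)) k)" for k
  \<comment> \<open>At the least differing position all earlier cells pass the check, so the head
    does arrive there.\<close>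
  define k where "k = (LEAST k. differ k)"
  have "\<exists>k. differ k"
    using assms(2) unfolding differ_def by (meson bit_eq_iff)
  then have k: "differ k"
    unfolding k_def by (rule LeastI_ex)
  \<comment> \<open>Beyond the width all bits are zero, so a difference must lie inside the written
    part.\<close>
  then have less: "k < width V"
    unfolding differ_def by (meson less_power_if_width_le not_bit_if_less not_le)
  have "run p w n (conf Check i (tape V) 0) (conf Check i (tape V) (int k))"
    using less assms(1) not_less_Least[of _ differ, folded k_def]
    by (intro run_check) (auto simp: differ_def)
  also have "run p w n \<dots> (conf Reject i (tape V) (int k))"
    by (rule run_step[where g = "tape V (int k)" and d = Stay and e = Stay])
      (use assms less k in \<open>auto simp: tape_def differ_def\<close>)
  finally show ?thesis
    by blast
qed

lemma run_counter_machine: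
  fixes p :: 'a
  assumes "\<And>j. j \<le> length w \<Longrightarrow> width (counts p (take j w)) \<le> n"
  defines "accepting \<equiv> w \<noteq> [] \<and> (\<forall>l. counts p w (True, l) = counts p w (False, l))"
  shows "\<exists>i t k. run p w n (initial_config (counter_machine p))
    (conf (if accepting then Accept else Reject) i t k)"
proof -
  let ?V = "counts p w"
  let ?N = "Suc (length w)"
  have "run p w n (initial_config (counter_machine p)) (conf Read ?N (tape ?V) 0)"
    using run_read[of w p n "length w"] assms(1) by (simp add: initial_config_counter_machine)
  moreover have "\<exists>i t k. run p w n (conf Read ?N (tape ?V) 0)
      (conf (if accepting then Accept else Reject) i t k)"
  proof (cases w rule: rev_cases)
    case Nil
    have "run p w n (conf Read ?N (tape ?V) 0) (conf Reject ?N (tape ?V) 0)"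
      by (rule run_step[where g = None and d = Stay and e = Stay])
        (use Nil in \<open>auto simp: tape_def input_cell_def\<close>)
    then show ?thesis
      using Nil by (auto simp: accepting_def)
  next
    case (snoc u a)
    then have "0 < width ?V"
      by (simp add: width_update_pos)
    then have check: "run p w n (conf Read ?N (tape ?V) 0) (conf Check ?N (tape ?V) 0)"
      by (intro run_step[where g = "tape ?V 0" and d = Stay and e = Stay])
        (auto simp: tape_def input_cell_def)
    have "\<exists>k. run p w n (conf Check ?N (tape ?V) 0)
        (conf (if accepting then Accept else Reject) ?N (tape ?V) k)"
    proof (cases accepting)
      case True
      then show ?thesis
        using run_accept[of ?V n p w ?N] assms(1)[of "length w"] by (auto simp: accepting_def)
    next
      case False
      then obtain l where "?V (True, l) \<noteq> ?V (False, l)"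
        using snoc by (auto simp: accepting_def)
      then show ?thesis
        using run_reject[of ?V n l p w ?N] assms(1)[of "length w"] False by auto
    qed
    with check show ?thesis
      by (meson rtranclp_trans)
  qed
  ultimately show ?thesis
    by (meson rtranclp_trans)
qed

section \<open>Logarithmic space\<close>

definition bit_length :: "nat \<Rightarrow> nat" where
  "bit_length N = (LEAST k. N < 2 ^ k)"

lemma less_power_bit_length: "N < 2 ^ bit_length N"
  unfolding bit_length_def by (rule LeastI) (rule less_exp)

lemma bit_length_le_ln:
  assumes "0 < N"
  shows "real (bit_length N) \<le> ln (real N) / ln 2 + 1"
proof (cases "bit_length N")
  case 0
  then show ?thesis
    using assms by simp
next
  case (Suc k)
  \<comment> \<open>Minimality of the bit length: one bit fewer does not suffice.\<close>
  then have "\<not> N < 2 ^ k"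
    unfolding bit_length_def by (intro not_less_Least) simp
  then have "real (2 ^ k) \<le> real N"
    by (simp only: of_nat_le_iff not_less)
  then have "real k * ln 2 \<le> ln (real N)"
    using assms by (metis ln_le_cancel_iff ln_realpow of_nat_0_less_iff of_nat_numeral of_nat_power
        zero_less_numeral zero_less_power)
  then show ?thesis
    by (simp add: Suc field_simps)
qed

lemma space_bound_bigo: "(\<lambda>N. real (2 * bit_length N + 2)) \<in> O(\<lambda>N. ln (real N))"
proof (rule bigoI)
  \<comment> \<open>The bound on \<open>bit_length\<close> gives 2 / ln 2 times ln N plus 4, and for
    N at least 3 the 4 is absorbed by 4 / ln 3 times ln N.\<close>
  show "\<forall>\<^sub>F N in sequentially.
      norm (real (2 * bit_length N + 2)) \<le> (2 / ln 2 + 4 / ln 3) * norm (ln (real N))"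
    using eventually_ge_at_top[of 3]
  proof eventually_elim
    case (elim N)
    then have "ln 3 \<le> ln (real N)"
      by simp
    then have "4 \<le> 4 / ln 3 * ln (real N)"
      by (simp add: field_simps)
    moreover have "real (bit_length N) \<le> ln (real N) / ln 2 + 1"
      using elim by (intro bit_length_le_ln) simp
    ultimately show ?case
      using elim by (simp add: algebra_simps)
  qed
qed

theorem equal_counts_in_LSPACE:
  assumes "finite \<Sigma>"
  shows "{w \<in> lists \<Sigma>. w \<noteq> [] \<and> (\<forall>l. counts p w (True, l) = counts p w (False, l))} \<in> LSPACE \<Sigma>"
    (is "?L \<in> _")
proof -
  let ?T = "counter_machine p"
  have halt: "(\<exists>t. state (config_at ?T w t) =
      (if w \<in> ?L then accept_state ?T else reject_state ?T)) \<and>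
      work_space ?T w \<le> 2 * bit_length (length w) + 2" if w: "w \<in> lists \<Sigma>" for w
  proof -
    let ?n = "2 * bit_length (length w)"
    \<comment> \<open>Squaring doubles the number of bits, which explains the factor 2 in
      \<open>?n\<close>.\<close>
    have "width (counts p (take j w)) \<le> ?n" if "j \<le> length w" for j
    proof (rule width_le)
      fix c
      have "counts p (take j w) c \<le> j\<^sup>2"
        using counts_le_square[of p "take j w" c] that by (simp add: min_absorb2)
      also have "\<dots> < (2 ^ bit_length (length w))\<^sup>2"
        using less_power_bit_length[of "length w"] that by (intro power_strict_mono) auto
      finally show "counts p (take j w) c < 2 ^ ?n"
        by (simp add: power_mult power2_eq_square mult_2 power_add)
    qed
    from run_counter_machine[OF this] obtain i t k where
      "run p w ?n (initial_config ?T) (conf (if w \<in> ?L then Accept else Reject) i t k)"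
      (is "run p w ?n _ ?c") using w by auto
    moreover have c: "state ?c = (if w \<in> ?L then accept_state ?T else reject_state ?T)"
      by (simp add: counter_machine_def)
    ultimately have h: "\<exists>t. config_at ?T w t = ?c"
      "\<And>t. work_pos (config_at ?T w t) \<in> {-1..int ?n}"
      using halting_run[of ?T w "{-1..int ?n}" ?c] by (auto split: if_splits)
    have "card (range (\<lambda>t. work_pos (config_at ?T w t))) \<le> card {-1..int ?n}"
      using h(2) by (intro card_mono) auto
    then have "work_space ?T w \<le> ?n + 2"
      by (simp add: work_space_def)
    moreover from h(1) obtain s where "config_at ?T w s = ?c" ..
    then have "state (config_at ?T w s) = (if w \<in> ?L then accept_state ?T else reject_state ?T)"
      by (simp only: c)
    ultimately show ?thesis
      by blast
  qed
  then have "decides \<Sigma> ?T ?L"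
    unfolding decides_def by blast
  moreover have "\<forall>w\<in>lists \<Sigma>. work_space ?T w \<le> 2 * bit_length (length w) + 2"
    using halt by blast
  ultimately show ?thesis
    unfolding LSPACE_def
    by (intro CollectI exI[of _ ?T] exI[of _ "\<lambda>N. 2 * bit_length N + 2"] conjI)
      (rule machine_over_counter_machine[OF assms] space_bound_bigo | assumption)+
qed

section \<open>Values in base \<open>M\<close>\<close>

text \<open>Horner's rule: the new letter is the term of index 0, and a factor \<open>M\<close>
  comes out of all the others.\<close>

lemma base_value_snoc: "base_value M (w @ [a]) = M *v base_value M w + a"
proof -
  have sum: "M *v (\<Sum>i<n. f i) = (\<Sum>i<n. M *v f i)" for n :: nat and f :: "nat \<Rightarrow> int ^ 'a"
    by (induction n) (simp_all add: matrix_vector_right_distrib)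
  show ?thesis
    unfolding base_value_def
    by (simp add: sum.lessThan_Suc_shift sum matrix_vector_mul_assoc del: sum.lessThan_Suc)
qed

text \<open>Multiplication by the matrix adds the second coordinate to the first, just as
  \<open>update\<close> adds plain counts to prefix sums; the new letter changes only the second
  coordinate, by 1 or -1.\<close>

lemma base_value_eq_counts:
  fixes v1 v2 :: "int ^ 2"
  assumes "v1 = vector [0, 1]" "v2 = vector [0, -1]" "w \<in> lists {v1, v2}"
  shows "base_value (vector [vector [1, 1], vector [0, 1]]) w =
    vector [int (counts v1 w (True, True)) - int (counts v1 w (False, True)),
      int (counts v1 w (True, False)) - int (counts v1 w (False, False))]"
  using assms(3)
proof (induction w rule: rev_induct)
  case Nil
  show ?case
    by (simp add: base_value_def vec_eq_iff forall_2)
next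
  case (snoc a w)
  \<comment> \<open>Without this, the letter \<open>v2\<close> would be counted as an occurrence of
    \<open>v1\<close>.\<close>
  have "v1 \<noteq> v2"
    by (simp add: assms(1,2) vec_eq_iff forall_2)
  with snoc show ?case
    by (auto simp: base_value_snoc update_def addend_def increment_def vec_eq_iff forall_2
        matrix_vector_mult_def sum_2 assms(1,2))
qed

theorem theorem4p2:
  fixes M :: "int ^ 2 ^ 2" and v1 v2 :: "int ^ 2" and L0 :: "(int ^ 2) list set"
  assumes "M = vector [vector [1, 1], vector [0, 1]]"
    and "v1 = vector [0, 1]"
    and "v2 = vector [0, -1]"
    and "L0 = {v \<in> lists {v1, v2}. v \<noteq> [] \<and> base_value M v = vector [0, 0]}"
  shows "L0 \<in> LSPACE {v1, v2}"
proof -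
  have "base_value M w = vector [0, 0] \<longleftrightarrow> (\<forall>l. counts v1 w (True, l) = counts v1 w (False, l))"
    if "w \<in> lists {v1, v2}" for w
    unfolding assms(1) base_value_eq_counts[OF assms(2,3) that]
    by (auto simp: vec_eq_iff forall_2 all_bool_eq)
  then have "L0 = {w \<in> lists {v1, v2}.
      w \<noteq> [] \<and> (\<forall>l. counts v1 w (True, l) = counts v1 w (False, l))}"
    unfolding assms(4) by blast
  then show ?thesis
    using equal_counts_in_LSPACE[of "{v1, v2}" v1] by simp
qed

end
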